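(* Let $N\ge1$, $p,q\in\mathbb R_+^N$, and $m\in[0,\min(p^T\mathbf 1,q^T\mathbf 1)]$. Let $$\mathcal C_1=\{\gamma\in\mathbb R_+^{N\times N}:\gamma\mathbf 1\le p\},\quad \mathcal C_2=\{\gamma\in\mathbb R_+^{N\times N}:\gamma^T\mathbf 1\le q\},\quad \mathcal C_3=\{\gamma\in\mathbb R_+^{N\times N}:\mathbf 1^T\gamma\mathbf 1=m\},$$ where inequalities are component-wise. Let $\gamma\in\mathbb R^{N\times N}$ have strictly positive entries, and for $k\in\{1,2,3\}$ denote by $\gamma^k=P^{\mathrm{KL}}_{\mathcal C_k}(\gamma)=\operatorname{argmin}_{\gamma'\in\mathcal C_k}\mathrm{KL}(\gamma'|\gamma)$ the Kullback-Leibler projection of $\gamma$ on $\mathcal C_k$. Then $$\gamma^1=\operatorname{diag}\!\left(\min\!\left(\frac{p}{\gamma\mathbf 1},\mathbf 1\right)\right)\gamma,\qquad \gamma^2=\gamma\operatorname{diag}\!\left(\min\!\left(\frac{q}{\gamma^T\mathbf 1},\mathbf 1\right)\right),\qquad \gamma^3=\gamma\,\frac{m}{\mathbf 1^T\gamma\mathbf 1},$$ where the quotients of vectors and the minimum are component-wise.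
   Context: $\mathbb R_+=[0,\infty)$; $\mathbf 1\in\mathbb R^N$ is the all-ones vector. For $\gamma'\in\mathbb R_+^{N\times N}$ and $\xi\in\mathbb R^{N\times N}$ with strictly positive entries, $\mathrm{KL}(\gamma'|\xi)=\sum_{i,j}\gamma'_{i,j}(\log(\gamma'_{i,j}/\xi_{i,j})-1)$, with the convention $0\log0=0$. *)

theory Defs
  imports "HOL-Analysis.Analysis"
begin

(* The convention 0 log 0 = 0 holds because the logarithm is multiplied by
   the entry of A, and ln is a total function. *)
definition KL :: "real^'n^'n \<Rightarrow> real^'n^'n \<Rightarrow> real" where
  "KL A B = (\<Sum>i\<in>UNIV. \<Sum>j\<in>UNIV. A $ i $ j * (ln (A $ i $ j / B $ i $ j) - 1))"

(* The set of all minimisers; a projection is well defined when this is a singleton. *)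
definition KL_proj :: "(real^'n^'n) set \<Rightarrow> real^'n^'n \<Rightarrow> (real^'n^'n) set" where
  "KL_proj C B = {A. is_arg_min (\<lambda>A'. KL A' B) (\<lambda>A'. A' \<in> C) A}"

(* On vectors and matrices, 1 is the all-ones vector and the order is component-wise. *)
definition C1 :: "real^'n \<Rightarrow> (real^'n^'n) set" where
  "C1 p = {A. 0 \<le> A \<and> A *v 1 \<le> p}"

definition C2 :: "real^'n \<Rightarrow> (real^'n^'n) set" where
  "C2 q = {A. 0 \<le> A \<and> transpose A *v 1 \<le> q}"

definition C3 :: "real \<Rightarrow> (real^'n^'n) set" where
  "C3 m = {A. 0 \<le> A \<and> 1 \<bullet> (A *v 1) = m}"

definition diag :: "real^'n \<Rightarrow> real^'n^'n" where
  "diag v = (\<chi> i j. if i = j then v $ i else 0)"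

(* Written out because min on vectors is not component-wise: the order there is partial. *)
definition min_quot :: "real^'n \<Rightarrow> real^'n \<Rightarrow> real^'n" where
  "min_quot u v = (\<chi> i. min (u $ i / v $ i) 1)"

end

theory Submission
  imports Defs
begin

text \<open>Each projection has the form \<open>Y i j = s i j * \<gamma> i j\<close>, so that the gradient of the objective
  at \<open>Y\<close> has entries \<open>ln (s i j)\<close>. The objective is strictly convex, so \<open>Y\<close> is the unique minimiser as
  soon as its first-order optimality condition holds on the constraint set. For the inequality
  constraints this is complementary slackness: a row whose scaling factor is less than \<open>1\<close>
  exhausts its capacity. Entries with \<open>s i j = 0\<close>, where the gradient is infinite, are forced to
  vanish by the constraint.\<close>

text \<open>For \<open>x > 0\<close> this is \<open>ln t \<le> t - 1\<close> at
  \<open>t = y / x\<close>, multiplied by \<open>x\<close>; equality forces \<open>t = 1\<close>.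
  The equality case is what later makes the minimiser unique.\<close>

lemma mult_ln_quotient_ge:
  fixes x y :: real
  assumes "0 \<le> x" "0 < y"
  shows "x - y \<le> x * ln (x / y)"
    and "x * ln (x / y) = x - y \<Longrightarrow> x = y"
proof -
  have *: "x - y < x * ln (x / y)" if "x \<noteq> y"
  proof (cases "x = 0")
    case False
    then have "0 < x" using assms by simp
    then have "0 < y / x" "y / x \<noteq> 1" using assms that by auto
    then have "ln (y / x) < y / x - 1"
      by (meson ln_le_minus_one ln_eq_minus_one order_less_le)
    then have "x * ln (y / x) < x * (y / x - 1)"
      using \<open>0 < x\<close> by simp
    also have "\<dots> = y - x" using \<open>0 < x\<close> by (simp add: field_simps)
    finally show ?thesis
      using \<open>0 < x\<close> assms by (simp add: ln_div algebra_simps)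
  qed (use assms in simp)
  show "x - y \<le> x * ln (x / y)" using * assms by (cases "x = y") auto
  show "x * ln (x / y) = x - y \<Longrightarrow> x = y" using * by (metis less_irrefl)
qed

text \<open>The derivative of \<open>h\<close> at \<open>s * b\<close> is \<open>ln s\<close>, so
  this is the tangent-line bound for a strictly convex summand. The gap is
  \<open>x * ln (x / (s * b)) - (x - s * b)\<close>. At \<open>s = 0\<close> there is no finite
  slope, but then \<open>x = 0\<close> and both sides vanish.\<close>

lemma KL_entry_first_order:
  fixes x b s :: real
  assumes "0 \<le> x" "0 < b" "0 \<le> s" "s = 0 \<Longrightarrow> x = 0"
  defines "h \<equiv> \<lambda>a. a * (ln (a / b) - 1)"
  shows "h (s * b) + ln s * (x - s * b) \<le> h x"
    and "h x = h (s * b) + ln s * (x - s * b) \<Longrightarrow> x = s * b"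
proof -
  have "h x - h (s * b) - ln s * (x - s * b) = x * ln (x / (s * b)) - (x - s * b)" if "s \<noteq> 0"
  proof (cases "x = 0")
    case False
    then show ?thesis using assms that
      by (simp add: h_def ln_div ln_mult algebra_simps)
  qed (use assms that in \<open>simp add: h_def algebra_simps\<close>)
  moreover have "0 < s * b" if "s \<noteq> 0" using assms that by simp
  moreover have "h 0 = 0" by (simp add: h_def)
  ultimately show "h (s * b) + ln s * (x - s * b) \<le> h x"
    and "h x = h (s * b) + ln s * (x - s * b) \<Longrightarrow> x = s * b"
    using mult_ln_quotient_ge[of x "s * b"] assms(1,4) by (cases "s = 0"; simp)+
qed

text \<open>Summing the tangent bounds shows that \<open>KL A \<gamma> - KL Y \<gamma>\<close> is at
  least the linear term in \<open>opt\<close>, strictly so if \<open>A\<close> differs from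
  \<open>Y\<close>. Entries with \<open>s i j = 0\<close> contribute nothing to that term, since
  \<open>A\<close> and \<open>Y\<close> both vanish there.\<close>

lemma KL_proj_eqI:
  fixes \<gamma> Y :: "real^'n^'n"
  assumes pos: "\<And>i j. 0 < \<gamma> $ i $ j"
    and s: "\<And>i j. 0 \<le> s i j" and Y: "\<And>i j. Y $ i $ j = s i j * \<gamma> $ i $ j"
    and "Y \<in> C"
    and nonneg: "\<And>A i j. A \<in> C \<Longrightarrow> 0 \<le> A $ i $ j"
    and zero: "\<And>A i j. A \<in> C \<Longrightarrow> s i j = 0 \<Longrightarrow> A $ i $ j = 0"
    and opt: "\<And>A. A \<in> C \<Longrightarrow> 0 \<le> (\<Sum>i\<in>UNIV. \<Sum>j\<in>UNIV. ln (s i j) * (A $ i $ j - Y $ i $ j))"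
  shows "KL_proj C \<gamma> = {Y}"
proof -
  have less: "KL Y \<gamma> < KL A \<gamma>" if "A \<in> C" "A \<noteq> Y" for A
  proof -
    define h where "h = (\<lambda>i j a. a * (ln (a / \<gamma> $ i $ j) - 1))"
    \<comment> \<open>The tangent to the summand at the entry of \<open>Y\<close>, evaluated at the
      entry of \<open>A\<close>.\<close>
    define l where "l = (\<lambda>i j. h i j (Y $ i $ j) + ln (s i j) * (A $ i $ j - Y $ i $ j))"
    have le: "l i j \<le> h i j (A $ i $ j)" and eq: "h i j (A $ i $ j) = l i j \<Longrightarrow> A $ i $ j = Y $ i $ j"
      for i j
      using KL_entry_first_order[OF nonneg pos s zero, OF \<open>A \<in> C\<close> \<open>A \<in> C\<close>, of i j]
      unfolding l_def h_def Y by auto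
    obtain i j where "A $ i $ j \<noteq> Y $ i $ j"
      using \<open>A \<noteq> Y\<close> by (auto simp: vec_eq_iff)
    then have "l i j < h i j (A $ i $ j)"
      using le[of i j] eq[of i j] by fastforce
    \<comment> \<open>One entry with strict inequality makes its row sum strict, and that row makes
      the double sum strict.\<close>
    then have "(\<Sum>i\<in>UNIV. \<Sum>j\<in>UNIV. l i j) < (\<Sum>i\<in>UNIV. \<Sum>j\<in>UNIV. h i j (A $ i $ j))"
      by (intro sum_strict_mono_ex1 ballI sum_mono bexI[of _ i] bexI[of _ j] le) auto
    moreover have "KL Y \<gamma> \<le> (\<Sum>i\<in>UNIV. \<Sum>j\<in>UNIV. l i j)"
      using opt[OF \<open>A \<in> C\<close>] by (simp add: KL_def l_def h_def sum.distrib)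
    ultimately show ?thesis by (simp add: KL_def h_def)
  qed
  then show ?thesis
    using \<open>Y \<in> C\<close> unfolding KL_proj_def is_arg_min_def
    by (auto dest: less_asym)
qed

text \<open>Isolates one row \<open>b\<close> with capacity \<open>c\<close>. If
  \<open>s < 1\<close>, the scaled row sums to exactly \<open>c\<close>, so every feasible
  \<open>x\<close> has total at most that, and \<open>ln s \<le> 0\<close> reverses the sign; if
  \<open>s = 1\<close>, the slope \<open>ln s\<close> is 0.\<close>

lemma scaling_below_capacity:
  fixes b :: "'k \<Rightarrow> real"
  assumes "finite K" "K \<noteq> {}" "0 \<le> c" and b: "\<And>k. k \<in> K \<Longrightarrow> 0 < b k"
  defines "s \<equiv> min (c / sum b K) 1"
  shows "0 \<le> s" and "(\<Sum>k\<in>K. s * b k) \<le> c"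
    and "\<lbrakk>\<And>k. k \<in> K \<Longrightarrow> 0 \<le> x k; sum x K \<le> c; s = 0; k \<in> K\<rbrakk> \<Longrightarrow> x k = 0"
    and "sum x K \<le> c \<Longrightarrow> 0 \<le> (\<Sum>k\<in>K. ln s * (x k - s * b k))"
proof -
  have B: "0 < sum b K" using assms by (intro sum_pos) auto
  show s0: "0 \<le> s" using B \<open>0 \<le> c\<close> by (simp add: s_def)
  have "s * sum b K \<le> c / sum b K * sum b K"
    using B by (intro mult_right_mono) (auto simp: s_def)
  then show "(\<Sum>k\<in>K. s * b k) \<le> c" using B by (simp flip: sum_distrib_left)
  show "x k = 0" if "\<And>k. k \<in> K \<Longrightarrow> 0 \<le> x k" "sum x K \<le> c" "s = 0" "k \<in> K"
  proof -
    \<comment> \<open>Because \<open>sum b K\<close> is positive, the factor vanishes only when the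
      capacity itself does.\<close>
    have "c = 0" using that B by (auto simp: s_def min_def split: if_splits)
    then have "sum x K = 0" using that sum_nonneg[of K x] by force
    then show ?thesis using that \<open>finite K\<close> by (simp add: sum_nonneg_eq_0_iff)
  qed
  show "0 \<le> (\<Sum>k\<in>K. ln s * (x k - s * b k))" if "sum x K \<le> c"
  \<comment> \<open>Both excluded values give \<open>ln s = 0\<close>, the first by the convention
    \<open>ln 0 = 0\<close>, so the sum is 0.\<close>
  proof (cases "s = 0 \<or> s = 1")
    case False
    then have "s = c / sum b K" "s < 1" unfolding s_def min_def by argo+
    then have "sum x K \<le> s * sum b K"
      using that B s0 False by simp
    moreover have "ln s \<le> 0"
      using s0 False \<open>s < 1\<close> by simp
    ultimately have "0 \<le> ln s * (sum x K - s * sum b K)" by (simp add: mult_nonpos_nonpos)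
    then show ?thesis by (simp add: sum_distrib_left sum_subtractf right_diff_distrib)
  qed auto
qed

text \<open>Both the constraint and the linear term split into rows, so the one-row facts apply to
  each row separately.\<close>

lemma KL_proj_C1:
  fixes p :: "real^'n" and \<gamma> :: "real^'n^'n"
  assumes p: "0 \<le> p" and pos: "\<And>i j. 0 < \<gamma> $ i $ j"
  shows "KL_proj (C1 p) \<gamma> = {diag (min_quot p (\<gamma> *v 1)) ** \<gamma>}"
proof -
  define s where "s i = min (p $ i / (\<Sum>j\<in>UNIV. \<gamma> $ i $ j)) 1" for i
  note cap = scaling_below_capacity[where K = UNIV and c = "p $ i" and b = "\<lambda>j. \<gamma> $ i $ j" for i,
      folded s_def]
  have p': "0 \<le> p $ i" for i using p by (simp add: less_eq_vec_def)
  have C1: "A \<in> C1 p \<longleftrightarrow> (\<forall>i j. 0 \<le> A $ i $ j) \<and> (\<forall>i. (\<Sum>j\<in>UNIV. A $ i $ j) \<le> p $ i)" for A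
    by (simp add: C1_def less_eq_vec_def matrix_vector_mult_def)
  have Y: "(diag (min_quot p (\<gamma> *v 1)) ** \<gamma>) $ i $ j = s i * \<gamma> $ i $ j" for i j
    by (simp add: diag_def min_quot_def matrix_matrix_mult_def matrix_vector_mult_def s_def
        if_distrib[of "\<lambda>x. x * _"] cong: if_cong)
  show ?thesis
  proof (rule KL_proj_eqI[where s = "\<lambda>i j. s i", OF pos _ Y])
    show "diag (min_quot p (\<gamma> *v 1)) ** \<gamma> \<in> C1 p"
      using cap(1,2) p' pos by (simp add: C1 Y less_imp_le)
    show "0 \<le> (\<Sum>i\<in>UNIV. \<Sum>j\<in>UNIV.
        ln (s i) * (A $ i $ j - (diag (min_quot p (\<gamma> *v 1)) ** \<gamma>) $ i $ j))" if "A \<in> C1 p" for A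
      unfolding Y using that p' pos by (intro sum_nonneg cap(4)) (auto simp: C1)
    show "A $ i $ j = 0" if "A \<in> C1 p" "s i = 0" for A i j
      using that p' pos cap(3)[of i "\<lambda>j. A $ i $ j" j] by (auto simp: C1)
  qed (use cap(1) p' pos in \<open>auto simp: C1\<close>)
qed

lemma KL_transpose: "KL (transpose A) (transpose B) = KL A B"
  unfolding KL_def by (subst sum.swap) (simp add: transpose_def)

text \<open>Transposition is an involution preserving \<open>KL\<close>, hence it carries minimisers
  to minimisers. This reduces column constraints to row constraints.\<close>

lemma KL_proj_transpose:
  fixes B :: "real^'n^'n"
  shows "KL_proj C (transpose B) = transpose ` KL_proj {A. transpose A \<in> C} B"
proof -
  have KL: "KL A (transpose B) = KL (transpose A) B" for A
    using KL_transpose[of "transpose A" B] by (simp only: transpose_transpose)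
  have "A \<in> KL_proj C (transpose B) \<longleftrightarrow> transpose A \<in> KL_proj {A. transpose A \<in> C} B" for A
  proof -
    \<comment> \<open>\<open>P A'\<close> says that \<open>A'\<close> does not beat
      \<open>A\<close>. Naming it lets the quantifier over competitors be reindexed by
      transposition.\<close>
    define P where "P A' \<longleftrightarrow> \<not> (A' \<in> C \<and> KL (transpose A') B < KL (transpose A) B)" for A'
    have "(\<forall>A'. P A') \<longleftrightarrow> (\<forall>A'. P (transpose A'))"
    proof (intro iffI allI)
      fix A' assume "\<forall>A'. P (transpose A')"
      then have "P (transpose (transpose A'))" by (rule spec)
      then show "P A'" by (simp only: transpose_transpose)
    qed simp
    then show ?thesis
      by (simp only: P_def KL_proj_def is_arg_min_def mem_Collect_eq not_ex KL transpose_transpose)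
  qed
  moreover have "A \<in> transpose ` S \<longleftrightarrow> transpose A \<in> S" for A :: "real^'n^'n" and S
  proof
    assume "transpose A \<in> S"
    then show "A \<in> transpose ` S"
      by (rule rev_image_eqI) (simp only: transpose_transpose)
  qed (auto simp only: transpose_transpose)
  ultimately show ?thesis by (intro set_eqI) (simp only:)
qed

text \<open>This is the row case for \<open>transpose \<gamma>\<close>, transposed back: diagonal
  matrices are symmetric and the product reverses its order.\<close>

lemma KL_proj_C2:
  fixes q :: "real^'n" and \<gamma> :: "real^'n^'n"
  assumes "0 \<le> q" and pos: "\<And>i j. 0 < \<gamma> $ i $ j"
  shows "KL_proj (C2 q) \<gamma> = {\<gamma> ** diag (min_quot q (transpose \<gamma> *v 1))}"
proof -
  have "transpose A \<in> C2 q \<longleftrightarrow> A \<in> C1 q" for A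
    by (auto simp: C1_def C2_def less_eq_vec_def transpose_def)
  moreover have "transpose (diag v) = diag v" for v :: "real^'n"
    by (simp add: diag_def transpose_def vec_eq_iff)
  moreover have "KL_proj (C1 q) (transpose \<gamma>)
      = {diag (min_quot q (transpose \<gamma> *v 1)) ** transpose \<gamma>}"
    using assms by (intro KL_proj_C1) (simp_all add: transpose_def)
  ultimately show ?thesis
    using KL_proj_transpose[of "C2 q" "transpose \<gamma>"]
    by (simp add: matrix_transpose_mul transpose_transpose del: transpose_matrix_vector)
qed

text \<open>The gradient at the candidate is the constant \<open>ln s\<close>, so the linear term is
  \<open>ln s\<close> times a difference of total masses, which is 0 because both equal
  \<open>m\<close>.\<close>

lemma KL_proj_C3:
  fixes \<gamma> :: "real^'n^'n"
  assumes m: "0 \<le> m" and pos: "\<And>i j. 0 < \<gamma> $ i $ j"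
  shows "KL_proj (C3 m) \<gamma> = {(m / (1 \<bullet> (\<gamma> *v 1))) *\<^sub>R \<gamma>}"
proof -
  have total: "1 \<bullet> (A *v 1) = (\<Sum>i\<in>UNIV. \<Sum>j\<in>UNIV. A $ i $ j)" for A :: "real^'n^'n"
    by (simp add: inner_vec_def matrix_vector_mult_def)
  have C3: "A \<in> C3 m \<longleftrightarrow> (\<forall>i j. 0 \<le> A $ i $ j) \<and> (\<Sum>i\<in>UNIV. \<Sum>j\<in>UNIV. A $ i $ j) = m" for A :: "real^'n^'n"
    unfolding C3_def total by (simp add: less_eq_vec_def)
  define s where "s = m / (1 \<bullet> (\<gamma> *v 1))"
  have T: "0 < 1 \<bullet> (\<gamma> *v 1)"
    unfolding total using pos by (intro sum_pos) auto
  have s: "0 \<le> s" using m T by (simp add: s_def)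
  have "s * (\<Sum>i\<in>UNIV. \<Sum>j\<in>UNIV. \<gamma> $ i $ j) = m"
    unfolding total[symmetric] using T by (simp add: s_def)
  then have sum: "(\<Sum>i\<in>UNIV. \<Sum>j\<in>UNIV. s * \<gamma> $ i $ j) = m"
    by (simp add: sum_distrib_left)
  show ?thesis
    unfolding s_def[symmetric]
  proof (rule KL_proj_eqI[where s = "\<lambda>i j. s", OF pos s])
    show "s *\<^sub>R \<gamma> \<in> C3 m" using s sum pos by (simp add: C3 less_imp_le)
    show "A $ i $ j = 0" if "A \<in> C3 m" "s = 0" for A :: "real^'n^'n" and i j
    proof -
      \<comment> \<open>A zero factor means zero prescribed mass, and nonnegative entries with total
        0 all vanish.\<close>
      have "m = 0" using that T by (simp add: s_def)
      then have nonneg: "\<And>i j. 0 \<le> A $ i $ j" and "(\<Sum>i\<in>UNIV. \<Sum>j\<in>UNIV. A $ i $ j) = 0"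
        using that unfolding C3 by auto
      then have "\<forall>i\<in>UNIV. (\<Sum>j\<in>UNIV. A $ i $ j) = 0"
        by (subst (asm) sum_nonneg_eq_0_iff) (auto intro: sum_nonneg)
      then show ?thesis using nonneg by (simp add: sum_nonneg_eq_0_iff)
    qed
    show "0 \<le> (\<Sum>i\<in>UNIV. \<Sum>j\<in>UNIV. ln s * (A $ i $ j - (s *\<^sub>R \<gamma>) $ i $ j))" if "A \<in> C3 m" for A
      using that sum by (simp add: C3 sum_subtractf flip: sum_distrib_left)
  qed (auto simp: C3)
qed

theorem proposition5:
  fixes p q :: "real^'n" and m :: real and \<gamma> :: "real^'n^'n"
  assumes "0 \<le> p" and "0 \<le> q"
    and "0 \<le> m" and "m \<le> min (p \<bullet> 1) (q \<bullet> 1)"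
    and "\<And>i j. 0 < \<gamma> $ i $ j"
  shows "KL_proj (C1 p) \<gamma> = {diag (min_quot p (\<gamma> *v 1)) ** \<gamma>}
    \<and> KL_proj (C2 q) \<gamma> = {\<gamma> ** diag (min_quot q (transpose \<gamma> *v 1))}
    \<and> KL_proj (C3 m) \<gamma> = {(m / (1 \<bullet> (\<gamma> *v 1))) *\<^sub>R \<gamma>}"
  using assms by (simp add: KL_proj_C1 KL_proj_C2 KL_proj_C3)

end
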